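(* Let $X=Y\setminus Z\subset\mathbb P^n$ ($n\ge2$) be a (possibly singular) quasi-projective variety, $\mathcal S$ a Whitney stratification of $Y$ with $Z$ a union of strata, $\mathcal L$ a hyperplane transverse to $\mathcal S$, and $\mathcal P$ a pencil of hyperplanes having $\mathcal L$ as a member and whose axis $\mathcal M$ is transverse to $\mathcal S$. Assume $\mathcal M\cap X\ne\emptyset$ and let $*\in\mathcal M\cap X$. Fix an index $i$ of an exceptional hyperplane $\mathcal L_i$ and an integer $q\ge1$, and let $\mathrm{VAR}_{i,q}\colon\pi_q(\mathcal L\cap X,\mathcal M\cap X,* )\to\pi_q(\mathcal L\cap X,* )$ be the generalized homotopical variation operator. If $\gamma$ is a loop in $\mathcal M\cap X$ based at $*$ and $f\in F^q(\mathcal L\cap X,\mathcal M\cap X,* )$, then $$\mathrm{VAR}_{i,q}\bigl(\langle\gamma\rangle_{\mathcal M\cap X,*}\cdot\langle f\rangle_{\mathcal L\cap X,\mathcal M\cap X,*}\bigr)=\langle\gamma\rangle_{\mathcal L\cap X,*}\cdot\mathrm{VAR}_{i,q}\bigl(\langle f\rangle_{\mathcal L\cap X,\mathcal M\cap X,*}\bigr),$$ where $\cdot$ denotes equally the action of $\pi_1(\mathcal M\cap X,* )$ on $\pi_q(\mathcal L\cap X,\mathcal M\cap X,* )$ and the action of $\pi_1(\mathcal L\cap X,* )$ on $\pi_q(\mathcal L\cap X,* )$.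
   Context: $Y$ is a non-empty closed algebraic subset of $\mathbb P^n$ and $Z$ a proper closed algebraic subset of $Y$. All members of $\mathcal P$ are transverse to (all strata of) $\mathcal S$ except finitely many, called exceptional hyperplanes $(\mathcal L_i)_i$ (one may also count finitely many ordinary members different from $\mathcal L$ as exceptional). Parametrize $\mathcal P$ by $\mathbb P^1$ as usual: $\mathcal P(\mu)$ is the member with parameter $\mu$, $\mathcal L=\mathcal P(\lambda)$, $\mathcal L_i=\mathcal P(\lambda_i)$. For $G\subset\mathbb P^n$, $E\subset\mathbb P^1$, put $G_E=\bigcup_{\mu\in E}G\cap\mathcal P(\mu)$. Loops. For each $i$ let $D_i\subset\mathbb P^1$ be a small closed semi-analytic disk with centre $\lambda_i$, the $D_i$ mutually disjoint, $\gamma_i\in\partial D_i$, and $\Gamma_i$ the image of a simple real-analytic arc joining $\lambda$ to $\gamma_i$, with $\Gamma_i\cap D_i=\{\gamma_i\}$, and $\Gamma_i\cap\Gamma_{i'}=\{\lambda\}$, $\Gamma_i\cap D_{i'}=\emptyset$ for $i\neq i'$. Put $K_i=\Gamma_i\cup D_i$. Let $\omega_i$ be the loop in $\partial K_i$ starting at $\lambda$, running along $\Gamma_i$ to $\gamma_i$, once counter-clockwise around $\partial D_i$, and back along $\Gamma_i$ to $\lambda$. Monodromy. For each $i$ there is an isotopy $\Theta\colon(\mathcal L\cap X)\times[0,1]\to X_{\partial K_i}$ with $\Theta(x,0)=x$, $\Theta(x,t)\in X_{\omega_i(t)}$, $x\mapsto\Theta(x,t)$ a homeomorphism $\mathcal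 L\cap X\to X_{\omega_i(t)}$ for every $t$, and $\Theta(x,t)=x$ for $x\in\mathcal M\cap X$. The homeomorphism $h=\Theta(\cdot,1)$ of $\mathcal L\cap X$ is called a geometric monodromy of $\mathcal L\cap X$ relative to $\mathcal M\cap X$ above $\omega_i$; it fixes $\mathcal M\cap X$ pointwise. Generalized homotopical variation. Let $I=[0,1]$. For a pointed pair $(A,B,* )$, $*\in B$, $F^q(A,B,* )$ is the set of maps $I^q\to A$ sending the face $x_q=0$ into $B$ and all other faces to $*$, and $F^q(A,* )$ the set of maps $I^q\to A$ sending $\partial I^q$ to $*$; $\langle f\rangle_{A,B,*}\in\pi_q(A,B,* )$ and $\langle f\rangle_{A,*}\in\pi_q(A,* )$ denote homotopy classes. For $f\in F^q(\mathcal L\cap X,\mathcal M\cap X,* )$, let $f\bot(h\circ f)\in F^q(\mathcal L\cap X,* )$ be the map equal to $f(x_1,\dots,x_{q-1},1-2x_q)$ if $0\le x_q\le\frac12$ and to $h\circ f(x_1,\dots,x_{q-1},2x_q-1)$ if $\frac12\le x_q\le1$. Then $\mathrm{VAR}_{i,q}(\langle f\rangle)=\langle f\bot(h\circ f)\rangle$ is a well-defined map depending only on the homotopy class of $\omega_i$ in $\mathbb P^1\setminus\bigcup_j\{\lambda_j\}$. Action of the fundamental group (usual one): for a loop $\gamma$ in $B$ based at $*$, with inverse loop $\gamma^-$, $\langle\gamma\rangle\cdot\langle f\rangle_{A,B,*}=\langle g\rangle_{A,B,*}$ where $g=\mathcal K(\cdot,1)$ for a homotopy $\mathcal K\colon(I^q,\partial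 I^q)\times I\to(A,B)$ with $\mathcal K(x,0)=f(x)$, $\mathcal K(x,t)=\gamma^-(t)$ for $x\in\partial I^q$ outside the face $x_q=0$ (hence also on the closure of this set), and $\mathcal K(x,t)\in B$ for $x$ in the face $x_q=0$. In the absolute case, $\mathcal K(x,t)=\gamma^-(t)$ for all $x\in\partial I^q$, with $\gamma$ a loop in $A$. *)

theory Defs
  imports
    "HOL-Analysis.Analysis"
    "HOL-Complex_Analysis.Winding_Numbers"
    "HOL-Library.Poly_Mapping"
    "HOL-Library.Disjoint_Sets"
begin

section \<open>Complex projective space\<close>

text \<open>
  Points are the lines through the origin of the space of vectors indexed by \<open>'n\<close>, so that
  the dimension of the projective space is \<open>CARD('n) - 1\<close>. In particular \<open>2 pspace\<close> is the
  projective line.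
\<close>

typedef 'n pspace = "{l :: (complex ^ 'n::finite) set. vec.subspace l \<and> vec.dim l = 1}"
proof -
  let ?e = "axis undefined 1 :: complex ^ 'n"
  have "vec.independent {?e}"
    by (rule vec.independent_if_scalars_zero) (auto simp: axis_eq_0_iff)
  then have "vec.dim (vec.span {?e}) = 1"
    using vec.dim_span_eq_card_independent[of "{?e}"] by simp
  then show ?thesis
    using vec.subspace_span[of "{?e}"] by (intro exI[of _ "vec.span {?e}"] CollectI conjI)
qed

definition coords :: "'n::finite pspace \<Rightarrow> (complex ^ 'n) set"
  where "coords p = Rep_pspace p - {0}"

text \<open>Only meaningful for \<open>v \<noteq> 0\<close>.\<close>

definition proj :: "complex ^ 'n::finite \<Rightarrow> 'n pspace"
  where "proj v = Abs_pspace (vec.span {v})"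

text \<open>The quotient topology of the punctured vector space.\<close>

instantiation pspace :: (finite) topological_space
begin

definition open_pspace :: "'a pspace set \<Rightarrow> bool"
  where "open_pspace U \<longleftrightarrow> open {v. v \<noteq> 0 \<and> proj v \<in> U}"

instance
proof
  have "{v :: complex ^ 'a. v \<noteq> 0 \<and> proj v \<in> UNIV} = - {0}" by auto
  then show "open (UNIV :: 'a pspace set)"
    unfolding open_pspace_def using open_Compl[OF closed_singleton] by metis
next
  fix S T :: "'a pspace set"
  assume *: "open S" "open T"
  have eq: "{v. v \<noteq> 0 \<and> proj v \<in> S \<inter> T}
      = {v. v \<noteq> 0 \<and> proj v \<in> S} \<inter> {v. v \<noteq> 0 \<and> proj v \<in> T}" by blast
  show "open (S \<inter> T)"
    unfolding open_pspace_def eq by (intro open_Int *[unfolded open_pspace_def])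
next
  fix K :: "'a pspace set set"
  assume *: "\<forall>S\<in>K. open S"
  have eq: "{v. v \<noteq> 0 \<and> proj v \<in> \<Union>K} = (\<Union>S\<in>K. {v. v \<noteq> 0 \<and> proj v \<in> S})" by blast
  show "open (\<Union>K)"
    unfolding open_pspace_def eq by (intro open_UN *[unfolded open_pspace_def])
qed

end

section \<open>Algebraic subsets\<close>

type_synonym 'n cpoly = "('n \<Rightarrow>\<^sub>0 nat) \<Rightarrow>\<^sub>0 complex"

definition poly_eval :: "'n::finite cpoly \<Rightarrow> complex ^ 'n \<Rightarrow> complex"
  where "poly_eval f v = (\<Sum>m\<in>Poly_Mapping.keys f. Poly_Mapping.lookup f m * (\<Prod>j\<in>UNIV. (v $ j) ^ Poly_Mapping.lookup m j))"

definition homogeneous_poly :: "'n::finite cpoly \<Rightarrow> bool"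
  where "homogeneous_poly f \<longleftrightarrow> (\<exists>d. \<forall>m\<in>Poly_Mapping.keys f. (\<Sum>j\<in>UNIV. Poly_Mapping.lookup m j) = d)"

definition closed_algebraic :: "'n::finite pspace set \<Rightarrow> bool"
  where "closed_algebraic A \<longleftrightarrow>
    (\<exists>F. (\<forall>f\<in>F. homogeneous_poly f) \<and> A = {p. \<forall>f\<in>F. \<forall>v\<in>coords p. poly_eval f v = 0})"

section \<open>Complex submanifolds, tangent spaces, transversality\<close>

definition holomorphic_map_on ::
    "(complex ^ 'n::finite \<Rightarrow> complex ^ 'n) \<Rightarrow> (complex ^ 'n) set \<Rightarrow> bool"
  where "holomorphic_map_on f U \<longleftrightarrow>
    (\<forall>x\<in>U. \<exists>f'. (f has_derivative f') (at x) \<and> (\<forall>c w. f' (c *s w) = c *s f' w))"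

definition complex_submanifold :: "(complex ^ 'n::finite) set \<Rightarrow> bool"
  where "complex_submanifold N \<longleftrightarrow>
    (\<forall>v\<in>N. \<exists>U V \<phi> \<psi> E. open U \<and> v \<in> U \<and> open V \<and> homeomorphism U V \<phi> \<psi> \<and>
      holomorphic_map_on \<phi> U \<and> holomorphic_map_on \<psi> V \<and>
      vec.subspace E \<and> \<phi> ` (N \<inter> U) = V \<inter> E)"

text \<open>The velocities at \<open>v\<close> of the curves contained in \<open>N\<close>.\<close>

definition tangent_space :: "(complex ^ 'n::finite) set \<Rightarrow> complex ^ 'n \<Rightarrow> (complex ^ 'n) set"
  where "tangent_space N v =
    {w. \<exists>c :: real \<Rightarrow> complex ^ 'n. c 0 = v \<and> (\<forall>\<^sub>F t in nhds 0. c t \<in> N) \<and>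
          (c has_vector_derivative w) (at 0)}"

text \<open>
  The standard affine chart with index \<open>j\<close> is identified with the affine hyperplane where the
  coordinate \<open>j\<close> equals 1; the tangent space of the latter is where the coordinate \<open>j\<close> vanishes.
\<close>

definition affine_part :: "'n::finite \<Rightarrow> 'n pspace set \<Rightarrow> (complex ^ 'n) set"
  where "affine_part j S = {v. v $ j = 1 \<and> proj v \<in> S}"

definition proj_submanifold :: "'n::finite pspace set \<Rightarrow> bool"
  where "proj_submanifold S \<longleftrightarrow> (\<forall>j. complex_submanifold (affine_part j S))"

definition transverse :: "'n::finite pspace set \<Rightarrow> 'n pspace set \<Rightarrow> bool"
  where "transverse S T \<longleftrightarrow>
    (\<forall>j. \<forall>v \<in> affine_part j S \<inter> affine_part j T.
      {u + w | u w. u \<in> tangent_space (affine_part j S) v \<and> w \<in> tangent_space (affine_part j T) v}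
        = {w. w $ j = 0})"

section \<open>Whitney stratifications\<close>

text \<open>
  Convergence in the Grassmannian: the dimension is eventually that of the limit and each
  vector of the limit is a limit of vectors of the given subspaces.
\<close>

definition grassmann_lim :: "(nat \<Rightarrow> (complex ^ 'n::finite) set) \<Rightarrow> (complex ^ 'n) set \<Rightarrow> bool"
  where "grassmann_lim T L \<longleftrightarrow>
    vec.subspace L \<and> (\<forall>\<^sub>F k in sequentially. vec.subspace (T k) \<and> vec.dim (T k) = vec.dim L) \<and>
    (\<forall>w\<in>L. \<exists>u. (\<forall>k. u k \<in> T k) \<and> u \<longlonglongrightarrow> w)"

definition whitney_a :: "'n::finite pspace set \<Rightarrow> 'n pspace set \<Rightarrow> bool"
  where "whitney_a R S \<longleftrightarrow>
    (\<forall>j x y T. (\<forall>k. x k \<in> affine_part j R) \<and> y \<in> affine_part j S \<and> x \<longlonglongrightarrow> y \<and>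
        grassmann_lim (\<lambda>k. tangent_space (affine_part j R) (x k)) T
      \<longrightarrow> tangent_space (affine_part j S) y \<subseteq> T)"

definition whitney_b :: "'n::finite pspace set \<Rightarrow> 'n pspace set \<Rightarrow> bool"
  where "whitney_b R S \<longleftrightarrow>
    (\<forall>j x y z T l. (\<forall>k. x k \<in> affine_part j R) \<and> (\<forall>k. z k \<in> affine_part j S) \<and>
        y \<in> affine_part j S \<and> x \<longlonglongrightarrow> y \<and> z \<longlonglongrightarrow> y \<and>
        grassmann_lim (\<lambda>k. tangent_space (affine_part j R) (x k)) T \<and>
        grassmann_lim (\<lambda>k. vec.span {x k - z k}) l
      \<longrightarrow> l \<subseteq> T)"

definition whitney_stratification :: "'n::finite pspace set \<Rightarrow> 'n pspace set set \<Rightarrow> bool"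
  where "whitney_stratification Y \<S> \<longleftrightarrow>
    finite \<S> \<and> partition_on Y \<S> \<and>
    (\<forall>S\<in>\<S>. connected S \<and> proj_submanifold S \<and>
       closed_algebraic (closure S) \<and> closed_algebraic (closure S - S)) \<and>
    (\<forall>R\<in>\<S>. \<forall>S\<in>\<S>. S \<inter> closure R \<noteq> {} \<longrightarrow> S \<subseteq> closure R) \<and>
    (\<forall>R\<in>\<S>. \<forall>S\<in>\<S>. R \<noteq> S \<longrightarrow> whitney_a R S \<and> whitney_b R S)"

definition transverse_to_strata :: "'n::finite pspace set \<Rightarrow> 'n pspace set set \<Rightarrow> bool"
  where "transverse_to_strata H \<S> \<longleftrightarrow> (\<forall>S\<in>\<S>. transverse H S)"

section \<open>Pencils of hyperplanes\<close>

definition hyperplane :: "complex ^ 'n::finite \<Rightarrow> 'n pspace set"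
  where "hyperplane a = {p. \<forall>v\<in>coords p. (\<Sum>j\<in>UNIV. a $ j * v $ j) = 0}"

text \<open>
  For linearly independent \<open>a\<close> and \<open>b\<close>: the member with parameter \<open>[s : t]\<close> of the pencil
  spanned by the hyperplanes of \<open>a\<close> and \<open>b\<close> is the hyperplane of \<open>s a + t b\<close>.
\<close>

definition lin_indep2 :: "complex ^ 'n::finite \<Rightarrow> complex ^ 'n \<Rightarrow> bool"
  where "lin_indep2 a b \<longleftrightarrow> (\<forall>s t. s *s a + t *s b = 0 \<longrightarrow> s = 0 \<and> t = 0)"

definition pencil :: "complex ^ 'n::finite \<Rightarrow> complex ^ 'n \<Rightarrow> 2 pspace \<Rightarrow> 'n pspace set"
  where "pencil a b \<mu> = {p. \<forall>m\<in>coords \<mu>. p \<in> hyperplane (m $ 1 *s a + m $ 2 *s b)}"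

definition pencil_axis :: "complex ^ 'n::finite \<Rightarrow> complex ^ 'n \<Rightarrow> 'n pspace set"
  where "pencil_axis a b = hyperplane a \<inter> hyperplane b"

definition over ::
    "complex ^ 'n::finite \<Rightarrow> complex ^ 'n \<Rightarrow> 'n pspace set \<Rightarrow> 2 pspace set \<Rightarrow> 'n pspace set"
  where "over a b G E = (\<Union>\<mu>\<in>E. G \<inter> pencil a b \<mu>)"

text \<open>
  The family \<open>l\<close> lists the parameters of all members that are not transverse to the strata, and
  possibly finitely many further parameters other than \<open>\<mu>0\<close>.
\<close>

definition exceptional_parameters ::
    "complex ^ 'n::finite \<Rightarrow> complex ^ 'n \<Rightarrow> 'n pspace set set \<Rightarrow> 2 pspace \<Rightarrow>
      'i set \<Rightarrow> ('i \<Rightarrow> 2 pspace) \<Rightarrow> bool"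
  where "exceptional_parameters a b \<S> \<mu>0 I l \<longleftrightarrow>
    finite I \<and> inj_on l I \<and> \<mu>0 \<notin> l ` I \<and>
    (\<forall>\<mu>. \<mu> \<notin> l ` I \<longrightarrow> transverse_to_strata (pencil a b \<mu>) \<S>)"

section \<open>Loops in the projective line\<close>

text \<open>
  For linearly independent \<open>p\<close> and \<open>q\<close>, a biholomorphic map of the complex plane onto the
  complement of \<open>[q]\<close> in the projective line.
\<close>

definition affine_param :: "complex ^ 2 \<Rightarrow> complex ^ 2 \<Rightarrow> complex \<Rightarrow> 2 pspace"
  where "affine_param p q z = proj (p + z *s q)"

definition real_analytic_on :: "(complex \<Rightarrow> real) \<Rightarrow> complex set \<Rightarrow> bool"
  where "real_analytic_on f U \<longleftrightarrow>
    (\<forall>z\<in>U. \<exists>(a :: nat \<times> nat \<Rightarrow> real) r. r > 0 \<and>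
      (\<forall>w\<in>ball z r. ((\<lambda>(j, k). a (j, k) * Re (w - z) ^ j * Im (w - z) ^ k) has_sum f w) UNIV))"

definition semianalytic :: "complex set \<Rightarrow> bool"
  where "semianalytic A \<longleftrightarrow>
    (\<forall>z. \<exists>U \<C>. open U \<and> z \<in> U \<and> finite \<C> \<and>
      (\<forall>(F, G)\<in>\<C>. finite F \<and> finite G \<and> (\<forall>f\<in>F \<union> G. real_analytic_on f U)) \<and>
      A \<inter> U = (\<Union>(F, G)\<in>\<C>. {w\<in>U. (\<forall>f\<in>F. f w = 0) \<and> (\<forall>g\<in>G. g w > 0)}))"

definition semianalytic_disk :: "2 pspace set \<Rightarrow> 2 pspace \<Rightarrow> bool"
  where "semianalytic_disk D c \<longleftrightarrow>
    (\<exists>\<phi> \<psi>. homeomorphism (cball (0 :: complex) 1) D \<phi> \<psi> \<and> \<phi> 0 = c) \<and>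
    (\<forall>p q. lin_indep2 p q \<longrightarrow> semianalytic (affine_param p q -` D))"

text \<open>Analyticity of the path is expressed in the standard affine charts of the projective line.\<close>

definition analytic_arc :: "(real \<Rightarrow> 2 pspace) \<Rightarrow> bool"
  where "analytic_arc g \<longleftrightarrow> arc g \<and>
    (\<forall>t0\<in>{0..1}. \<exists>j (a :: nat \<Rightarrow> complex ^ 2) r. r > 0 \<and>
      (\<forall>t\<in>{0..1} \<inter> ball t0 r. \<exists>v\<in>coords (g t). v $ j = 1 \<and>
         (\<lambda>k. (t - t0) ^ k *\<^sub>R a k) sums v))"

text \<open>
  \<open>\<beta>\<close> runs once counter-clockwise around the boundary of the disk \<open>D\<close>, whose centre is \<open>c\<close>; the
  orientation is read in an affine coordinate whose point at infinity is outside \<open>D\<close>.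
\<close>

definition ccw_boundary_loop :: "2 pspace set \<Rightarrow> 2 pspace \<Rightarrow> (real \<Rightarrow> 2 pspace) \<Rightarrow> bool"
  where "ccw_boundary_loop D c \<beta> \<longleftrightarrow>
    path_image \<beta> = frontier D \<and>
    (\<exists>p q z0 \<zeta>. lin_indep2 p q \<and> proj q \<notin> D \<and> affine_param p q z0 = c \<and>
       simple_path \<zeta> \<and> pathfinish \<zeta> = pathstart \<zeta> \<and> z0 \<notin> path_image \<zeta> \<and>
       winding_number \<zeta> z0 = 1 \<and> (\<forall>t\<in>{0..1}. \<beta> t = affine_param p q (\<zeta> t)))"

text \<open>
  \<open>D i\<close> is a disk centred at \<open>l i\<close>; the image of \<open>g i\<close> is the arc joining \<open>\<mu>0\<close> to the
  point \<open>pathfinish (g i)\<close> of the boundary of \<open>D i\<close>.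
\<close>

definition disks_and_arcs ::
    "2 pspace \<Rightarrow> 'i set \<Rightarrow> ('i \<Rightarrow> 2 pspace) \<Rightarrow> ('i \<Rightarrow> 2 pspace set) \<Rightarrow>
      ('i \<Rightarrow> real \<Rightarrow> 2 pspace) \<Rightarrow> bool"
  where "disks_and_arcs \<mu>0 I l D g \<longleftrightarrow>
    (\<forall>i\<in>I. semianalytic_disk (D i) (l i)) \<and> disjoint_family_on D I \<and>
    (\<forall>i\<in>I. analytic_arc (g i) \<and> pathstart (g i) = \<mu>0 \<and> pathfinish (g i) \<in> frontier (D i) \<and>
       path_image (g i) \<inter> D i = {pathfinish (g i)}) \<and>
    (\<forall>i\<in>I. \<forall>j\<in>I. i \<noteq> j \<longrightarrow>
       path_image (g i) \<inter> path_image (g j) = {\<mu>0} \<and> path_image (g i) \<inter> D j = {})"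

definition lasso :: "(real \<Rightarrow> 'a::topological_space) \<Rightarrow> (real \<Rightarrow> 'a) \<Rightarrow> real \<Rightarrow> 'a"
  where "lasso g \<beta> = g +++ (\<beta> +++ reversepath g)"

section \<open>Geometric monodromies\<close>

text \<open>
  \<open>h\<close> is a geometric monodromy of \<open>\<L> \<inter> X\<close> relative to \<open>\<M> \<inter> X\<close> above the loop \<open>\<omega>\<close>
  contained in \<open>B\<close>, where \<open>\<L>\<close> is the member with parameter \<open>\<mu>0\<close> and \<open>\<M>\<close> the axis.
\<close>

definition geometric_monodromy ::
    "complex ^ 'n::finite \<Rightarrow> complex ^ 'n \<Rightarrow> 2 pspace \<Rightarrow> 'n pspace set \<Rightarrow> 2 pspace set \<Rightarrow>
      (real \<Rightarrow> 2 pspace) \<Rightarrow> ('n pspace \<Rightarrow> 'n pspace) \<Rightarrow> bool"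
  where "geometric_monodromy a b \<mu>0 X B \<omega> h \<longleftrightarrow>
    (\<exists>\<Theta> :: 'n pspace \<times> real \<Rightarrow> 'n pspace.
      continuous_on ((pencil a b \<mu>0 \<inter> X) \<times> {0..1}) \<Theta> \<and>
      \<Theta> ` ((pencil a b \<mu>0 \<inter> X) \<times> {0..1}) \<subseteq> over a b X B \<and>
      (\<forall>x \<in> pencil a b \<mu>0 \<inter> X. \<Theta> (x, 0) = x) \<and>
      (\<forall>t\<in>{0..1}. \<exists>\<psi>. homeomorphism (pencil a b \<mu>0 \<inter> X) (over a b X {\<omega> t}) (\<lambda>x. \<Theta> (x, t)) \<psi>) \<and>
      (\<forall>x \<in> pencil_axis a b \<inter> X. \<forall>t\<in>{0..1}. \<Theta> (x, t) = x) \<and>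
      (\<forall>x \<in> pencil a b \<mu>0 \<inter> X. h x = \<Theta> (x, 1)))"

section \<open>Homotopy sets\<close>

text \<open>The coordinates of the cube are numbered from 1 to \<open>q\<close>.\<close>

definition cube :: "nat \<Rightarrow> (nat \<Rightarrow> real) set"
  where "cube q = {1..q} \<rightarrow>\<^sub>E {0..1}"

definition cube_boundary :: "nat \<Rightarrow> (nat \<Rightarrow> real) set"
  where "cube_boundary q = {x \<in> cube q. \<exists>k\<in>{1..q}. x k = 0 \<or> x k = 1}"

definition cube_bottom :: "nat \<Rightarrow> (nat \<Rightarrow> real) set"
  where "cube_bottom q = {x \<in> cube q. x q = 0}"

text \<open>
  The union of the faces other than \<open>x\<^sub>q = 0\<close>, that is, the closure of the part of the boundary
  outside that face.
\<close>

definition cube_sides :: "nat \<Rightarrow> (nat \<Rightarrow> real) set"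
  where "cube_sides q = {x \<in> cube q. \<exists>k\<in>{1..q}. x k = 1 \<or> (x k = 0 \<and> k \<noteq> q)}"

definition Frel ::
    "nat \<Rightarrow> 'a::topological_space set \<Rightarrow> 'a set \<Rightarrow> 'a \<Rightarrow> ((nat \<Rightarrow> real) \<Rightarrow> 'a) set"
  where "Frel q A B b = {f. continuous_on (cube q) f \<and> f ` cube q \<subseteq> A \<and>
    f ` cube_bottom q \<subseteq> B \<and> (\<forall>x\<in>cube_sides q. f x = b)}"

definition Fabs :: "nat \<Rightarrow> 'a::topological_space set \<Rightarrow> 'a \<Rightarrow> ((nat \<Rightarrow> real) \<Rightarrow> 'a) set"
  where "Fabs q A b = {f. continuous_on (cube q) f \<and> f ` cube q \<subseteq> A \<and>
    (\<forall>x\<in>cube_boundary q. f x = b)}"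

text \<open>
  Maps are total functions of which only the values on the cube matter; the classes below
  contain all functions with the same values on the cube.
\<close>

definition rel_class ::
    "nat \<Rightarrow> 'a::topological_space set \<Rightarrow> 'a set \<Rightarrow> 'a \<Rightarrow> ((nat \<Rightarrow> real) \<Rightarrow> 'a) \<Rightarrow>
      ((nat \<Rightarrow> real) \<Rightarrow> 'a) set"
  where "rel_class q A B b f =
    {g. homotopic_with_canon (\<lambda>u. u \<in> Frel q A B b) (cube q) A f g}"

definition abs_class ::
    "nat \<Rightarrow> 'a::topological_space set \<Rightarrow> 'a \<Rightarrow> ((nat \<Rightarrow> real) \<Rightarrow> 'a) \<Rightarrow> ((nat \<Rightarrow> real) \<Rightarrow> 'a) set"
  where "abs_class q A b f =
    {g. homotopic_with_canon (\<lambda>u. u \<in> Fabs q A b) (cube q) A f g}"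

definition loop_at :: "'a::topological_space set \<Rightarrow> 'a \<Rightarrow> (real \<Rightarrow> 'a) \<Rightarrow> bool"
  where "loop_at B b \<gamma> \<longleftrightarrow>
    path \<gamma> \<and> path_image \<gamma> \<subseteq> B \<and> pathstart \<gamma> = b \<and> pathfinish \<gamma> = b"

definition loop_class :: "'a::topological_space set \<Rightarrow> (real \<Rightarrow> 'a) \<Rightarrow> (real \<Rightarrow> 'a) set"
  where "loop_class B \<gamma> = {\<gamma>'. homotopic_paths B \<gamma> \<gamma>'}"

text \<open>The actions of the fundamental group, on homotopy classes \<open>c\<close> of loops and \<open>d\<close> of maps.\<close>

definition rel_action ::
    "nat \<Rightarrow> 'a::topological_space set \<Rightarrow> 'a set \<Rightarrow> 'a \<Rightarrow> (real \<Rightarrow> 'a) set \<Rightarrow>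
      ((nat \<Rightarrow> real) \<Rightarrow> 'a) set \<Rightarrow> ((nat \<Rightarrow> real) \<Rightarrow> 'a) set"
  where "rel_action q A B b c d =
    (THE e. \<exists>\<gamma>\<in>c. \<exists>f\<in>d. \<exists>K :: (nat \<Rightarrow> real) \<times> real \<Rightarrow> 'a.
       continuous_on (cube q \<times> {0..1}) K \<and> K ` (cube q \<times> {0..1}) \<subseteq> A \<and>
       (\<forall>x\<in>cube q. K (x, 0) = f x) \<and>
       (\<forall>x\<in>cube_sides q. \<forall>t\<in>{0..1}. K (x, t) = reversepath \<gamma> t) \<and>
       K ` (cube_bottom q \<times> {0..1}) \<subseteq> B \<and>
       e = rel_class q A B b (\<lambda>x. K (x, 1)))"

definition abs_action ::
    "nat \<Rightarrow> 'a::topological_space set \<Rightarrow> 'a \<Rightarrow> (real \<Rightarrow> 'a) set \<Rightarrow>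
      ((nat \<Rightarrow> real) \<Rightarrow> 'a) set \<Rightarrow> ((nat \<Rightarrow> real) \<Rightarrow> 'a) set"
  where "abs_action q A b c d =
    (THE e. \<exists>\<gamma>\<in>c. \<exists>f\<in>d. \<exists>K :: (nat \<Rightarrow> real) \<times> real \<Rightarrow> 'a.
       continuous_on (cube q \<times> {0..1}) K \<and> K ` (cube q \<times> {0..1}) \<subseteq> A \<and>
       (\<forall>x\<in>cube q. K (x, 0) = f x) \<and>
       (\<forall>x\<in>cube_boundary q. \<forall>t\<in>{0..1}. K (x, t) = reversepath \<gamma> t) \<and>
       e = abs_class q A b (\<lambda>x. K (x, 1)))"

section \<open>Generalized homotopical variation\<close>

definition perp ::
    "nat \<Rightarrow> ((nat \<Rightarrow> real) \<Rightarrow> 'a) \<Rightarrow> ((nat \<Rightarrow> real) \<Rightarrow> 'a) \<Rightarrow> (nat \<Rightarrow> real) \<Rightarrow> 'a"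
  where "perp q f g x =
    (if x q \<le> 1/2 then f (x(q := 1 - 2 * x q)) else g (x(q := 2 * x q - 1)))"

text \<open>The variation defined by a geometric monodromy \<open>h\<close>, on homotopy classes \<open>d\<close>.\<close>

definition VAR ::
    "nat \<Rightarrow> 'a::topological_space set \<Rightarrow> 'a \<Rightarrow> ('a \<Rightarrow> 'a) \<Rightarrow>
      ((nat \<Rightarrow> real) \<Rightarrow> 'a) set \<Rightarrow> ((nat \<Rightarrow> real) \<Rightarrow> 'a) set"
  where "VAR q A b h d = (THE e. \<exists>f\<in>d. e = abs_class q A b (perp q f (h \<circ> f)))"

end

theory Submission
  imports Defs
begin

text \<open>
  The two actions and the variation are well defined, so that one homotopy \<open>K\<close> dragging \<open>f\<close> along
  the inverse of \<open>\<gamma>\<close> suffices: as \<open>h\<close> fixes \<open>\<M> \<inter> X\<close> pointwise, \<open>perp q (K\<^sub>t) (h \<circ> K\<^sub>t)\<close> is defined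
  for every \<open>t\<close>, and its boundary values follow the same path, so it drags the variation of \<open>f\<close>.
  Existence of \<open>K\<close> and independence of all choices come from one collar construction: expand the
  cube by the factor \<open>1 + 2t\<close>, apply the given map where the result is still in the cube, and let
  the remaining collar travel along the path at a depth measured by the overflow.
\<close>

section \<open>The collar construction\<close>

text \<open>
  The set \<open>J\<close> selects the lower faces \<open>x\<^sub>k = 0\<close> on which maps are prescribed: \<open>J = - {q}\<close> is the
  relative case and \<open>J = UNIV\<close> the absolute one.
\<close>

definition faces :: "nat set \<Rightarrow> nat \<Rightarrow> (nat \<Rightarrow> real) set"
  where "faces J q = {x \<in> cube q. \<exists>k\<in>{1..q}. x k = 1 \<or> (x k = 0 \<and> k \<in> J)}"

text \<open>Coordinates in \<open>J\<close> expand about 1/2, the others about 0. Thus for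
  \<open>t \<ge> 0\<close> a lower face that is not prescribed stays in place and cannot be left
  downwards.\<close>

definition stretch :: "nat set \<Rightarrow> real \<Rightarrow> nat \<Rightarrow> real \<Rightarrow> real"
  where "stretch J t k r = (if k \<in> J then r + t * (2 * r - 1) else r + t * r)"

definition clamped :: "nat set \<Rightarrow> nat \<Rightarrow> real \<Rightarrow> (nat \<Rightarrow> real) \<Rightarrow> nat \<Rightarrow> real"
  where "clamped J q t x =
    (\<lambda>k. if k \<in> {1..q} then max 0 (min 1 (stretch J t k (x k))) else undefined)"

text \<open>Truncating at \<open>t\<close> makes the overflow equal to \<open>t\<close> on all prescribed faces.\<close>

definition overflow :: "nat set \<Rightarrow> nat \<Rightarrow> real \<Rightarrow> (nat \<Rightarrow> real) \<Rightarrow> real"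
  where "overflow J q t x =
    min t (\<Sum>k\<in>{1..q}. \<bar>stretch J t k (x k) - max 0 (min 1 (stretch J t k (x k)))\<bar>)"

text \<open>The two cases fit together when \<open>\<phi>\<close> equals \<open>\<nu> 0\<close> on
  the prescribed faces, since a point with positive overflow is clamped onto one of them.\<close>

definition collar ::
    "nat set \<Rightarrow> nat \<Rightarrow> real \<Rightarrow> ((nat \<Rightarrow> real) \<Rightarrow> 'a) \<Rightarrow> (real \<Rightarrow> 'a) \<Rightarrow> (nat \<Rightarrow> real) \<Rightarrow> 'a"
  where "collar J q t \<phi> \<nu> x =
    (if overflow J q t x = 0 then \<phi> (clamped J q t x) else \<nu> (overflow J q t x))"

section \<open>Clamping and overflow of a stretched point\<close>

lemma cube_coord: "x \<in> cube q \<Longrightarrow> k \<in> {1..q} \<Longrightarrow> 0 \<le> x k \<and> x k \<le> 1"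
  by (auto simp: cube_def PiE_iff)

lemma clamped_in_cube: "clamped J q t x \<in> cube q"
  by (auto simp: clamped_def cube_def)

text \<open>If \<open>q \<in> J\<close>, the last coordinate is stretched to \<open>- t\<close> and
  clamped back to 0; otherwise it remains 0. Hence a collar respects the condition on the bottom
  face.\<close>

lemma clamped_in_bottom:
  assumes "q \<ge> 1" "x \<in> cube_bottom q" "t \<ge> 0"
  shows "clamped J q t x \<in> cube_bottom q"
  using assms clamped_in_cube[of J q t x]
  by (auto simp: cube_bottom_def clamped_def stretch_def)

lemma clamped_0: "x \<in> cube q \<Longrightarrow> clamped J q 0 x = x"
  by (rule ext) (auto simp: clamped_def stretch_def cube_def PiE_iff extensional_def)

lemma overflow_in: "0 \<le> t \<Longrightarrow> t \<le> 1 \<Longrightarrow> overflow J q t x \<in> {0..1}"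
  by (auto simp: overflow_def min_le_iff_disj intro!: sum_nonneg)

lemma overflow_0: "overflow J q 0 x = 0"
  by (auto simp: overflow_def min_def intro!: antisym sum_nonneg)

text \<open>A single prescribed coordinate already overshoots the unit interval by exactly
  \<open>t\<close>, and the truncation removes whatever the other coordinates add.\<close>

lemma overflow_faces:
  assumes "x \<in> faces J q" "t \<ge> 0"
  shows "overflow J q t x = t"
proof -
  let ?e = "\<lambda>k. \<bar>stretch J t k (x k) - max 0 (min 1 (stretch J t k (x k)))\<bar>"
  obtain k where k: "k \<in> {1..q}" "x k = 1 \<or> x k = 0 \<and> k \<in> J"
    using assms by (auto simp: faces_def)
  have "t \<le> ?e k" using k(2) assms(2) by (auto simp: stretch_def)
  also have "\<dots> \<le> sum ?e {1..q}" using k(1) by (intro member_le_sum) auto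
  finally show ?thesis by (simp add: overflow_def)
qed

text \<open>Some coordinate is moved by the clamping, so it lands on 0 or 1. It can land on 0 only
  if \<open>k \<in> J\<close>, because the other coordinates are stretched to nonnegative
  values.\<close>

lemma clamped_in_faces:
  assumes "x \<in> cube q" "t \<ge> 0" "overflow J q t x \<noteq> 0"
  shows "clamped J q t x \<in> faces J q"
proof -
  let ?e = "\<lambda>k. \<bar>stretch J t k (x k) - max 0 (min 1 (stretch J t k (x k)))\<bar>"
  have "sum ?e {1..q} \<noteq> 0" using assms by (auto simp: overflow_def)
  then obtain k where k: "k \<in> {1..q}" "?e k \<noteq> 0" by (meson sum.neutral)
  have "0 \<le> x k" using cube_coord assms(1) k(1) by blast
  then have "clamped J q t x k = 1 \<or> clamped J q t x k = 0 \<and> k \<in> J"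
    using k assms(2) by (auto simp: clamped_def stretch_def max_def min_def split: if_splits)
  then show ?thesis using k(1) clamped_in_cube by (auto simp: faces_def)
qed

section \<open>Continuity and values of collars\<close>

lemma continuous_on_stretch:
  fixes x :: "'a::topological_space \<Rightarrow> nat \<Rightarrow> real"
  assumes "continuous_on S t" "continuous_on S x"
  shows "continuous_on S (\<lambda>p. stretch J (t p) k (x p k))"
proof -
  have "continuous_on S (\<lambda>p. x p k)"
    by (rule continuous_on_product_then_coordinatewise[OF assms(2)])
  then show ?thesis unfolding stretch_def using assms(1)
    by (cases "k \<in> J") (auto intro!: continuous_intros)
qed

lemma continuous_on_clamped:
  fixes x :: "'a::topological_space \<Rightarrow> nat \<Rightarrow> real"
  assumes "continuous_on S t" "continuous_on S x"
  shows "continuous_on S (\<lambda>p. clamped J q (t p) (x p))"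
proof (rule continuous_on_coordinatewise_then_product)
  fix k
  show "continuous_on S (\<lambda>p. clamped J q (t p) (x p) k)"
    unfolding clamped_def
    by (cases "k \<in> {1..q}") (auto intro!: continuous_intros continuous_on_stretch assms)
qed

lemma continuous_on_overflow:
  fixes x :: "'a::topological_space \<Rightarrow> nat \<Rightarrow> real"
  assumes "continuous_on S t" "continuous_on S x"
  shows "continuous_on S (\<lambda>p. overflow J q (t p) (x p))"
  unfolding overflow_def
  by (intro continuous_intros continuous_on_stretch assms)

lemma closed_coordinate_eq: "closed {x :: nat \<Rightarrow> real. x k = c}"
  by (intro closed_Collect_eq continuous_on_product_coordinates continuous_on_const)

text \<open>The inner map, the path and the depth may all vary with \<open>s\<close>, so that the
  same gluing serves the existence of a dragging and the homotopies that prove uniqueness.\<close>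

lemma continuous_on_collar:
  fixes F :: "real \<Rightarrow> (nat \<Rightarrow> real) \<Rightarrow> 'a::topological_space"
  assumes F: "continuous_on (S \<times> cube q) (\<lambda>(s, x). F s x)"
    and N: "continuous_on (S \<times> {0..1}) (\<lambda>(s, u). N s u)"
    and lam: "continuous_on S lam" "lam ` S \<subseteq> {0..1}"
    and match: "\<And>s x. s \<in> S \<Longrightarrow> x \<in> faces J q \<Longrightarrow> F s x = N s 0"
  shows "continuous_on (S \<times> cube q) (\<lambda>(s, x). collar J q (lam s) (F s) (N s) x)"
proof -
  let ?U = "S \<times> cube q"
  let ?ov = "\<lambda>p. overflow J q (lam (fst p)) (snd p)"
  let ?cl = "\<lambda>p. clamped J q (lam (fst p)) (snd p)"
  let ?c = "\<lambda>p. collar J q (lam (fst p)) (F (fst p)) (N (fst p)) (snd p)"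
  \<comment> \<open>These slices of the whole space meet the cube in \<open>faces J q\<close>, and
    their closedness is immediate.\<close>
  define C where "C = (\<Union>k\<in>{1..q}. {x :: nat \<Rightarrow> real. x k = 1} \<union> (if k \<in> J then {x. x k = 0} else {}))"
  \<comment> \<open>The set of positive overflow is in general not closed. \<open>Q\<close> is a
    closed set containing it, so the domain is covered by two closed pieces.\<close>
  define P Q where "P = ?U \<inter> ?ov -` {0}" and "Q = ?U \<inter> ?cl -` C"
  have "closed C" unfolding C_def by (intro closed_UN) (auto intro!: closed_Un closed_coordinate_eq)
  have C: "clamped J q t x \<in> C \<longleftrightarrow> clamped J q t x \<in> faces J q" for t x
    using clamped_in_cube by (auto simp: C_def faces_def)
  have lamc: "continuous_on ?U (\<lambda>p. lam (fst p))"
    by (rule continuous_on_compose2[OF lam(1)]) (auto intro!: continuous_intros)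
  have ov: "continuous_on ?U ?ov" and cl: "continuous_on ?U ?cl"
    by (intro continuous_on_overflow continuous_on_clamped lamc continuous_on_snd continuous_on_id)+
  have "p \<in> P \<union> Q" if "p \<in> ?U" for p
    using that lam(2) clamped_in_faces[of "snd p" q "lam (fst p)" J]
    by (cases "?ov p = 0") (auto simp: P_def Q_def C image_subset_iff)
  then have U: "?U = P \<union> Q" by (auto simp: P_def Q_def)
  have "closedin (top_of_set (P \<union> Q)) P"
    unfolding U[symmetric] unfolding P_def by (intro continuous_closedin_preimage ov) auto
  moreover have "closedin (top_of_set (P \<union> Q)) Q"
    unfolding U[symmetric] unfolding Q_def
    by (intro continuous_closedin_preimage cl \<open>closed C\<close>)
  moreover have "continuous_on P ?c"
  proof -
    have "continuous_on P (\<lambda>p. (\<lambda>(s, x). F s x) (fst p, ?cl p))"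
      by (rule continuous_on_compose2[OF F])
        (auto intro!: continuous_intros continuous_on_subset[OF cl] simp: P_def clamped_in_cube)
    then show ?thesis
      by (rule continuous_on_eq) (auto simp: P_def collar_def)
  qed
  moreover have "continuous_on Q ?c"
  proof -
    have "continuous_on Q (\<lambda>p. (\<lambda>(s, u). N s u) (fst p, ?ov p))"
    proof (rule continuous_on_compose2[OF N])
      show "continuous_on Q (\<lambda>p. (fst p, ?ov p))"
        by (auto intro!: continuous_intros continuous_on_subset[OF ov] simp: Q_def)
      have "?ov p \<in> {0..1}" if "p \<in> Q" for p
        by (rule overflow_in) (use lam(2) that in \<open>auto simp: Q_def\<close>)
      then show "(\<lambda>p. (fst p, ?ov p)) ` Q \<subseteq> S \<times> {0..1}" by (auto simp: Q_def)
    qed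
    \<comment> \<open>Points of \<open>Q\<close> with overflow 0 are evaluated by \<open>F s\<close>
      on a prescribed face, and \<open>match\<close> turns this into \<open>N s 0\<close>.\<close>
    then show ?thesis
      by (rule continuous_on_eq) (auto simp: Q_def C collar_def match)
  qed
  ultimately have "continuous_on (P \<union> Q) ?c" by (rule continuous_on_Un_local)
  then show ?thesis unfolding U[symmetric] by (simp add: case_prod_beta)
qed

lemma collar_in:
  assumes "\<phi> ` cube q \<subseteq> A" "\<nu> ` {0..1} \<subseteq> A" "0 \<le> t" "t \<le> 1"
  shows "collar J q t \<phi> \<nu> x \<in> A"
  using assms clamped_in_cube[of J q t x] overflow_in[of t J q x]
  by (simp add: collar_def image_subset_iff)

lemma collar_bottom:
  assumes "\<phi> ` cube_bottom q \<subseteq> B" "\<nu> ` {0..1} \<subseteq> B" "0 \<le> t" "t \<le> 1" "q \<ge> 1" "x \<in> cube_bottom q"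
  shows "collar J q t \<phi> \<nu> x \<in> B"
  using assms clamped_in_bottom[of q x t J] overflow_in[of t J q x]
  by (simp add: collar_def image_subset_iff)

lemma collar_0: "x \<in> cube q \<Longrightarrow> collar J q 0 \<phi> \<nu> x = \<phi> x"
  by (simp add: collar_def overflow_0 clamped_0)

lemma collar_faces:
  assumes "x \<in> faces J q" "t \<ge> 0" "\<And>y. y \<in> faces J q \<Longrightarrow> \<phi> y = \<nu> 0"
  shows "collar J q t \<phi> \<nu> x = \<nu> t"
\<comment> \<open>For \<open>t = 0\<close> the overflow vanishes everywhere, so the value comes from
  \<open>\<phi>\<close> and not from \<open>\<nu>\<close>.\<close>
proof (cases "t = 0")
  case True
  have "x \<in> cube q" using assms(1) by (simp add: faces_def)
  then show ?thesis using True assms by (simp add: collar_0)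
qed (simp add: collar_def overflow_faces[OF assms(1,2)])

section \<open>Dragging maps of the cube along a path\<close>

text \<open>The absolute case takes \<open>B = A\<close>, which makes the condition on the bottom
  face vacuous.\<close>

definition Fgen ::
    "nat set \<Rightarrow> nat \<Rightarrow> 'a::topological_space set \<Rightarrow> 'a set \<Rightarrow> 'a \<Rightarrow> ((nat \<Rightarrow> real) \<Rightarrow> 'a) set"
  where "Fgen J q A B b = {f. continuous_on (cube q) f \<and> f ` cube q \<subseteq> A \<and>
    f ` cube_bottom q \<subseteq> B \<and> (\<forall>x\<in>faces J q. f x = b)}"

definition gen_class ::
    "nat set \<Rightarrow> nat \<Rightarrow> 'a::topological_space set \<Rightarrow> 'a set \<Rightarrow> 'a \<Rightarrow> ((nat \<Rightarrow> real) \<Rightarrow> 'a) \<Rightarrow>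
      ((nat \<Rightarrow> real) \<Rightarrow> 'a) set"
  where "gen_class J q A B b f =
    {g. homotopic_with_canon (\<lambda>u. u \<in> Fgen J q A B b) (cube q) A f g}"

text \<open>Time comes first and is curried, the form in which collars and \<open>perp\<close> are
  shown continuous. The end map \<open>K 1\<close> represents the class acted on by
  \<open>\<gamma>\<close>.\<close>

definition drags ::
    "nat set \<Rightarrow> nat \<Rightarrow> 'a::topological_space set \<Rightarrow> 'a set \<Rightarrow> (real \<Rightarrow> 'a) \<Rightarrow>
      ((nat \<Rightarrow> real) \<Rightarrow> 'a) \<Rightarrow> (real \<Rightarrow> (nat \<Rightarrow> real) \<Rightarrow> 'a) \<Rightarrow> bool"
  where "drags J q A B \<gamma> f K \<longleftrightarrow>
    continuous_on ({0..1} \<times> cube q) (\<lambda>(t, x). K t x) \<and>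
    (\<forall>t\<in>{0..1}. K t ` cube q \<subseteq> A \<and> K t ` cube_bottom q \<subseteq> B) \<and>
    (\<forall>x\<in>cube q. K 0 x = f x) \<and> (\<forall>x\<in>faces J q. \<forall>t\<in>{0..1}. K t x = reversepath \<gamma> t)"

lemma faces_subset: "faces J q \<subseteq> cube q" and bottom_subset: "cube_bottom q \<subseteq> cube q"
  by (auto simp: faces_def cube_bottom_def)

lemma Frel_eq_Fgen: "Frel q A B b = Fgen (- {q}) q A B b"
  by (simp add: Frel_def Fgen_def cube_sides_def faces_def)

lemma Fabs_eq_Fgen: "Fabs q A b = Fgen UNIV q A A b"
proof -
  have "cube_boundary q = faces UNIV q" by (auto simp: cube_boundary_def faces_def)
  then show ?thesis using bottom_subset[of q] by (auto simp: Fabs_def Fgen_def)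
qed

lemma rel_class_eq_gen_class: "rel_class q A B b f = gen_class (- {q}) q A B b f"
  by (simp add: rel_class_def gen_class_def Frel_eq_Fgen)

lemma abs_class_eq_gen_class: "abs_class q A b f = gen_class UNIV q A A b f"
  by (simp add: abs_class_def gen_class_def Fabs_eq_Fgen)

lemma Fgen_cong:
  assumes eq: "\<And>x. x \<in> cube q \<Longrightarrow> f x = g x"
  shows "f \<in> Fgen J q A B b \<longleftrightarrow> g \<in> Fgen J q A B b"
proof -
  have "f ` cube q = g ` cube q" "f ` cube_bottom q = g ` cube_bottom q"
    using eq bottom_subset[of q] by (auto intro!: image_cong)
  moreover have "(\<forall>x\<in>faces J q. f x = b) \<longleftrightarrow> (\<forall>x\<in>faces J q. g x = b)"
    using eq faces_subset[of J q] by (metis subsetD)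
  moreover have "continuous_on (cube q) f \<longleftrightarrow> continuous_on (cube q) g"
    using eq by (intro continuous_on_cong) auto
  ultimately show ?thesis unfolding Fgen_def by simp
qed

text \<open>This passes from homotopies between abstract topologies to curried families on the cube.
  The target \<open>A\<close> is absorbed in \<open>Fgen\<close>.\<close>

lemma gen_class_iff:
  "g \<in> gen_class J q A B b f \<longleftrightarrow>
    (\<exists>H :: real \<Rightarrow> (nat \<Rightarrow> real) \<Rightarrow> 'a::topological_space. continuous_on ({0..1} \<times> cube q) (\<lambda>(t, x). H t x) \<and> (\<forall>t\<in>{0..1}. H t \<in> Fgen J q A B b) \<and>
      (\<forall>x\<in>cube q. H 0 x = f x) \<and> (\<forall>x\<in>cube q. H 1 x = g x))" (is "?l \<longleftrightarrow> ?r")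
proof -
  have *: "?l \<longleftrightarrow> (\<exists>H. continuous_map (top_of_set ({0..1::real} \<times> cube q)) (top_of_set A) H \<and>
      (\<forall>x\<in>cube q. H (0, x) = f x) \<and> (\<forall>x\<in>cube q. H (1, x) = g x) \<and>
      (\<forall>t\<in>{0..1}. (\<lambda>x. H (t, x)) \<in> Fgen J q A B b))"
    unfolding gen_class_def mem_Collect_eq
  proof (subst homotopic_with)
    \<comment> \<open>Unpacking \<open>homotopic_with\<close> requires that the property depend only
      on the values on the cube.\<close>
    show "u \<in> Fgen J q A B b \<longleftrightarrow> v \<in> Fgen J q A B b" if "\<And>x. x \<in> topspace (top_of_set (cube q)) \<Longrightarrow> u x = v x" for u v
      using that by (intro Fgen_cong) auto
  qed (simp add: subtopology_Times)
  show ?thesis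
  proof
    assume ?l
    then obtain H where "continuous_on ({0..1::real} \<times> cube q) H"
      "\<forall>x\<in>cube q. H (0, x) = f x" "\<forall>x\<in>cube q. H (1, x) = g x"
      "\<forall>t\<in>{0..1}. (\<lambda>x. H (t, x)) \<in> Fgen J q A B b"
      unfolding * continuous_map_subtopology_eu by (elim exE conjE)
    then show ?r by (intro exI[of _ "\<lambda>t x. H (t, x)"]) auto
  next
    assume ?r
    then obtain H where "continuous_on ({0..1::real} \<times> cube q) (\<lambda>(t, x). H t x)"
      "\<forall>t\<in>{0..1}. H t \<in> Fgen J q A B b"
      "\<forall>x\<in>cube q. H 0 x = f x" "\<forall>x\<in>cube q. H 1 x = g x" by blast
    then show ?l unfolding *
      by (intro exI[of _ "\<lambda>(t, x). H t x"]) (auto simp: Fgen_def image_subset_iff)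
  qed
qed

lemma gen_classI:
  fixes H :: "real \<Rightarrow> (nat \<Rightarrow> real) \<Rightarrow> 'a::topological_space"
  assumes "continuous_on ({0..1} \<times> cube q) (\<lambda>(t, x). H t x)"
    and "\<And>t. t \<in> {0..1} \<Longrightarrow> H t \<in> Fgen J q A B b"
    and "\<And>x. x \<in> cube q \<Longrightarrow> H 0 x = f x" "\<And>x. x \<in> cube q \<Longrightarrow> H 1 x = g x"
  shows "g \<in> gen_class J q A B b f"
  unfolding gen_class_iff by (rule exI[of _ H]) (intro conjI ballI assms)

lemma gen_classE:
  fixes f :: "(nat \<Rightarrow> real) \<Rightarrow> 'a::topological_space"
  assumes "g \<in> gen_class J q A B b f"
  obtains H :: "real \<Rightarrow> (nat \<Rightarrow> real) \<Rightarrow> 'a" where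
    "continuous_on ({0..1} \<times> cube q) (\<lambda>(t, x). H t x)"
    "\<And>t. t \<in> {0..1} \<Longrightarrow> H t \<in> Fgen J q A B b"
    "\<And>x. x \<in> cube q \<Longrightarrow> H 0 x = f x" "\<And>x. x \<in> cube q \<Longrightarrow> H 1 x = g x"
proof -
  obtain H :: "real \<Rightarrow> (nat \<Rightarrow> real) \<Rightarrow> 'a" where
    "continuous_on ({0..1} \<times> cube q) (\<lambda>(t, x). H t x)" "\<forall>t\<in>{0..1}. H t \<in> Fgen J q A B b"
    "\<forall>x\<in>cube q. H 0 x = f x" "\<forall>x\<in>cube q. H 1 x = g x"
    using assms unfolding gen_class_iff by (elim exE conjE)
  then show thesis by (intro that[of H]) auto
qed

lemma gen_class_refl: "f \<in> Fgen J q A B b \<Longrightarrow> f \<in> gen_class J q A B b f"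
  by (auto simp: gen_class_def Fgen_def homotopic_with_refl)

lemma gen_class_eq: "g \<in> gen_class J q A B b f \<Longrightarrow> gen_class J q A B b f = gen_class J q A B b g"
  unfolding gen_class_def using homotopic_with_sym homotopic_with_trans by blast

lemma gen_class_imp_Fgen: "g \<in> gen_class J q A B b f \<Longrightarrow> g \<in> Fgen J q A B b"
  unfolding gen_class_def using homotopic_with_imp_property by blast

section \<open>Existence of draggings and uniqueness of their end class\<close>

lemma reversepath_loop:
  assumes "loop_at B b \<gamma>"
  shows "continuous_on {0..1} (reversepath \<gamma>)" "reversepath \<gamma> ` {0..1} \<subseteq> B"
    "reversepath \<gamma> 0 = b" "reversepath \<gamma> 1 = b"
  using assms path_reversepath[of \<gamma>] path_image_reversepath[of \<gamma>]
  by (auto simp: loop_at_def path_def path_image_def pathstart_def pathfinish_def reversepath_def)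

lemma drags_exists:
  assumes q: "q \<ge> 1" and BA: "B \<subseteq> A" and \<gamma>: "loop_at B b \<gamma>" and f: "f \<in> Fgen J q A B b"
  shows "\<exists>K. drags J q A B \<gamma> f K"
proof -
  let ?K = "\<lambda>t. collar J q t f (reversepath \<gamma>)"
  note r = reversepath_loop[OF \<gamma>]
  have f': "continuous_on (cube q) f" "f ` cube q \<subseteq> A" "f ` cube_bottom q \<subseteq> B"
    "\<And>x. x \<in> faces J q \<Longrightarrow> f x = reversepath \<gamma> 0"
    using f r(3) by (auto simp: Fgen_def)
  have "continuous_on ({0..1} \<times> cube q) (\<lambda>(t, x). ?K t x)"
  proof (rule continuous_on_collar)
    show "continuous_on ({0..1::real} \<times> cube q) (\<lambda>(s, x). f x)"
      unfolding case_prod_beta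
      by (rule continuous_on_compose2[OF f'(1)]) (auto intro: continuous_on_snd continuous_on_id)
    show "continuous_on ({0..1::real} \<times> {0..1}) (\<lambda>(s, u). reversepath \<gamma> u)"
      unfolding case_prod_beta
      by (rule continuous_on_compose2[OF r(1)]) (auto intro!: continuous_intros)
  qed (use f'(4) in \<open>auto intro!: continuous_intros\<close>)
  moreover have "?K t ` cube q \<subseteq> A" "?K t ` cube_bottom q \<subseteq> B" if "t \<in> {0..1}" for t
    using that f'(2,3) r(2) BA q
      collar_in[of f q A "reversepath \<gamma>" t J] collar_bottom[of f q B "reversepath \<gamma>" t _ J]
    by auto
  ultimately have "drags J q A B \<gamma> f ?K"
    using f'(4) by (auto simp: drags_def collar_0 collar_faces)
  then show ?thesis by blast
qed

text \<open>Stop the dragging at time \<open>s\<close> and let a collar of depth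
  \<open>1 - s\<close> run along the rest of the path. The prescribed faces then always go to
  \<open>b\<close>, and \<open>s\<close> from 0 to 1 leads from the collar of \<open>f\<close> to
  \<open>K 1\<close>. So the class of \<open>K 1\<close> does not depend on
  \<open>K\<close>.\<close>

lemma drags_homotopic_collar:
  assumes q: "q \<ge> 1" and BA: "B \<subseteq> A" and \<gamma>: "loop_at B b \<gamma>" and K: "drags J q A B \<gamma> f K"
  shows "K 1 \<in> gen_class J q A B b (collar J q 1 f (reversepath \<gamma>))"
proof -
  \<comment> \<open>The minimum keeps the remaining path defined for every \<open>u\<close> in the
    unit interval; the collar reaches only \<open>u \<le> 1 - s\<close>, where it has no
    effect.\<close>
  let ?N = "\<lambda>s u. reversepath \<gamma> (min 1 (s + u))"
  let ?H = "\<lambda>s. collar J q (1 - s) (K s) (?N s)"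
  note r = reversepath_loop[OF \<gamma>]
  have K': "continuous_on ({0..1} \<times> cube q) (\<lambda>(t, x). K t x)"
    "\<And>t. t \<in> {0..1} \<Longrightarrow> K t ` cube q \<subseteq> A" "\<And>t. t \<in> {0..1} \<Longrightarrow> K t ` cube_bottom q \<subseteq> B"
    "\<And>x. x \<in> cube q \<Longrightarrow> K 0 x = f x"
    "\<And>x t. x \<in> faces J q \<Longrightarrow> t \<in> {0..1} \<Longrightarrow> K t x = ?N t 0"
    using K by (auto simp: drags_def)
  have H: "continuous_on ({0..1} \<times> cube q) (\<lambda>(t, x). ?H t x)"
  proof (rule continuous_on_collar[OF K'(1)])
    show "continuous_on ({0..1} \<times> {0..1}) (\<lambda>(s, u). ?N s u)"
      unfolding case_prod_beta
      by (rule continuous_on_compose2[OF r(1)]) (auto intro!: continuous_intros)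
  qed (use K'(5) in \<open>auto intro!: continuous_intros\<close>)
  have Hf: "?H t \<in> Fgen J q A B b" if t: "t \<in> {0..1}" for t
  proof -
    have N: "?N t ` {0..1} \<subseteq> B" using r(2) t by (auto simp: image_subset_iff)
    have "continuous_on (cube q) (\<lambda>x. (\<lambda>(t, x). ?H t x) (t, x))"
      by (rule continuous_on_compose2[OF H]) (use t in \<open>auto intro!: continuous_intros\<close>)
    moreover have "?H t x \<in> A" for x
      by (rule collar_in) (use t K'(2) N BA in auto)
    moreover have "?H t x \<in> B" if "x \<in> cube_bottom q" for x
      by (rule collar_bottom) (use that q t K'(3) N in auto)
    moreover have "?H t x = b" if "x \<in> faces J q" for x
      by (subst collar_faces) (use that t K'(5) r(4) in auto)
    ultimately show ?thesis by (auto simp: Fgen_def)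
  qed
  \<comment> \<open>\<open>K 0\<close> agrees with \<open>f\<close> only on the cube, but clamped
    points always lie there.\<close>
  have H0: "?H 0 x = collar J q 1 f (reversepath \<gamma>) x" for x
    using overflow_in[of 1 J q x] K'(4) by (auto simp: collar_def clamped_in_cube)
  have H1: "?H 1 x = K 1 x" if "x \<in> cube q" for x
    using that by (simp add: collar_0)
  show ?thesis by (rule gen_classI[of q ?H, OF H Hf H0 H1])
qed

text \<open>Collars of full depth are formed from the stages of both homotopies at once. As the
  homotopy of loops fixes endpoints, inner map and path match at every stage and the prescribed
  faces stay at \<open>b\<close>.\<close>

lemma collar_homotopic:
  assumes q: "q \<ge> 1" and BA: "B \<subseteq> A" and \<gamma>: "loop_at B b \<gamma>"
    and f: "f' \<in> gen_class J q A B b f" and \<gamma>': "\<gamma>' \<in> loop_class B \<gamma>"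
  shows "collar J q 1 f' (reversepath \<gamma>') \<in> gen_class J q A B b (collar J q 1 f (reversepath \<gamma>))"
proof -
  obtain F :: "real \<Rightarrow> (nat \<Rightarrow> real) \<Rightarrow> 'a" where F: "continuous_on ({0..1} \<times> cube q) (\<lambda>(t, x). F t x)"
    "\<And>t. t \<in> {0..1} \<Longrightarrow> F t \<in> Fgen J q A B b"
    "\<And>x. x \<in> cube q \<Longrightarrow> F 0 x = f x" "\<And>x. x \<in> cube q \<Longrightarrow> F 1 x = f' x"
    by (rule gen_classE[OF f]) (rule that)
  have \<gamma>01: "\<gamma> 0 = b" "\<gamma> 1 = b" using \<gamma> by (auto simp: loop_at_def pathstart_def pathfinish_def)
  have "homotopic_paths B \<gamma> \<gamma>'" using \<gamma>' by (simp add: loop_class_def)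
  then obtain G :: "real \<times> real \<Rightarrow> 'a" where
    G: "continuous_on ({0..1} \<times> {0..1}) G" "G \<in> {0..1} \<times> {0..1} \<rightarrow> B"
      "\<forall>x\<in>{0..1}. G (0, x) = \<gamma> x" "\<forall>x\<in>{0..1}. G (1, x) = \<gamma>' x"
    and "\<forall>t\<in>{0..1}. pathstart (G \<circ> Pair t) = pathstart \<gamma> \<and> pathfinish (G \<circ> Pair t) = pathfinish \<gamma>"
    unfolding homotopic_paths by (elim exE conjE)
  then have Gb: "G (t, 0) = b" "G (t, 1) = b" if "t \<in> {0..1}" for t
    using that \<gamma>01 by (auto simp: pathstart_def pathfinish_def)
  let ?N = "\<lambda>s u. G (s, 1 - u)"
  let ?H = "\<lambda>s. collar J q 1 (F s) (?N s)"
  have F': "F t ` cube q \<subseteq> A" "F t ` cube_bottom q \<subseteq> B" "\<And>x. x \<in> faces J q \<Longrightarrow> F t x = ?N t 0"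
    if "t \<in> {0..1}" for t
    using F(2)[OF that] Gb(2)[OF that] by (auto simp: Fgen_def)
  have H: "continuous_on ({0..1} \<times> cube q) (\<lambda>(t, x). ?H t x)"
  proof (rule continuous_on_collar[OF F(1)])
    show "continuous_on ({0..1} \<times> {0..1}) (\<lambda>(s, u). ?N s u)"
      unfolding case_prod_beta
      by (rule continuous_on_compose2[OF G(1)]) (auto intro!: continuous_intros)
  qed (use F'(3) in \<open>auto intro!: continuous_intros\<close>)
  have Hf: "?H t \<in> Fgen J q A B b" if t: "t \<in> {0..1}" for t
  proof -
    have N: "?N t ` {0..1} \<subseteq> B" using G(2) t by (auto simp: Pi_iff)
    have "continuous_on (cube q) (\<lambda>x. (\<lambda>(t, x). ?H t x) (t, x))"
      by (rule continuous_on_compose2[OF H]) (use t in \<open>auto intro!: continuous_intros\<close>)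
    moreover have "?H t x \<in> A" for x
      by (rule collar_in) (use t F'(1) N BA in auto)
    moreover have "?H t x \<in> B" if "x \<in> cube_bottom q" for x
      by (rule collar_bottom) (use that q t F'(2) N in auto)
    moreover have "?H t x = b" if "x \<in> faces J q" for x
      by (subst collar_faces) (use that t F'(3) Gb(1) in auto)
    ultimately show ?thesis by (auto simp: Fgen_def)
  qed
  have H0: "?H 0 x = collar J q 1 f (reversepath \<gamma>) x" for x
    using overflow_in[of 1 J q x] F(3) G(3) by (auto simp: collar_def clamped_in_cube reversepath_def)
  have H1: "?H 1 x = collar J q 1 f' (reversepath \<gamma>') x" for x
    using overflow_in[of 1 J q x] F(4) G(4) by (auto simp: collar_def clamped_in_cube reversepath_def)
  show ?thesis by (rule gen_classI[of q ?H, OF H Hf H0 H1])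
qed

lemma loop_class_refl: "loop_at B b \<gamma> \<Longrightarrow> \<gamma> \<in> loop_class B \<gamma>"
  by (simp add: loop_class_def loop_at_def)

lemma loop_at_loop_class: "loop_at B b \<gamma> \<Longrightarrow> \<gamma>' \<in> loop_class B \<gamma> \<Longrightarrow> loop_at B b \<gamma>'"
  by (auto simp: loop_class_def loop_at_def dest: homotopic_paths_imp_path
      homotopic_paths_imp_subset homotopic_paths_imp_pathstart homotopic_paths_imp_pathfinish)

text \<open>Two draggings are compared through the collars of their own data, whose classes agree;
  this makes the definite description meaningful.\<close>

lemma gen_action_eq:
  assumes q: "q \<ge> 1" and BA: "B \<subseteq> A" and \<gamma>: "loop_at B b \<gamma>" and f: "f \<in> Fgen J q A B b"
    and K: "drags J q A B \<gamma> f K"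
  shows "(THE e. \<exists>\<gamma>'\<in>loop_class B \<gamma>. \<exists>f'\<in>gen_class J q A B b f. \<exists>K. drags J q A B \<gamma>' f' K \<and>
            e = gen_class J q A B b (K 1)) = gen_class J q A B b (K 1)"
proof (rule the_equality)
  show "\<exists>\<gamma>'\<in>loop_class B \<gamma>. \<exists>f'\<in>gen_class J q A B b f. \<exists>K'. drags J q A B \<gamma>' f' K' \<and>
            gen_class J q A B b (K 1) = gen_class J q A B b (K' 1)"
    using K loop_class_refl[OF \<gamma>] gen_class_refl[OF f] by blast
next
  fix e
  assume "\<exists>\<gamma>'\<in>loop_class B \<gamma>. \<exists>f'\<in>gen_class J q A B b f. \<exists>K. drags J q A B \<gamma>' f' K \<and>
            e = gen_class J q A B b (K 1)"
  then obtain \<gamma>' f' K' where *: "\<gamma>' \<in> loop_class B \<gamma>" "f' \<in> gen_class J q A B b f"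
    "drags J q A B \<gamma>' f' K'" "e = gen_class J q A B b (K' 1)" by blast
  have "gen_class J q A B b (K 1) = gen_class J q A B b (collar J q 1 f (reversepath \<gamma>))"
    using gen_class_eq drags_homotopic_collar[OF q BA \<gamma> K] by metis
  also have "\<dots> = gen_class J q A B b (collar J q 1 f' (reversepath \<gamma>'))"
    using gen_class_eq collar_homotopic[OF q BA \<gamma> *(2,1)] by metis
  also have "\<dots> = gen_class J q A B b (K' 1)"
    using gen_class_eq drags_homotopic_collar[OF q BA loop_at_loop_class[OF \<gamma> *(1)] *(3)] by metis
  finally show "e = gen_class J q A B b (K 1)" using *(4) by simp
qed

section \<open>The two actions expressed by draggings\<close>

lemma ex_drags_iff:
  "(\<exists>K :: (nat \<Rightarrow> real) \<times> real \<Rightarrow> 'a::topological_space.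
       continuous_on (cube q \<times> {0..1}) K \<and> K ` (cube q \<times> {0..1}) \<subseteq> A \<and>
       (\<forall>x\<in>cube q. K (x, 0) = f x) \<and>
       (\<forall>x\<in>faces J q. \<forall>t\<in>{0..1}. K (x, t) = reversepath \<gamma> t) \<and>
       K ` (cube_bottom q \<times> {0..1}) \<subseteq> B \<and> P (\<lambda>x. K (x, 1)))
   \<longleftrightarrow> (\<exists>K. drags J q A B \<gamma> f K \<and> P (K 1))" (is "?l \<longleftrightarrow> ?r")
proof
  assume ?l
  then obtain K where K: "continuous_on (cube q \<times> {0..1}) K" "K ` (cube q \<times> {0..1}) \<subseteq> A"
       "\<forall>x\<in>cube q. K (x, 0) = f x" "\<forall>x\<in>faces J q. \<forall>t\<in>{0..1}. K (x, t) = reversepath \<gamma> t"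
       "K ` (cube_bottom q \<times> {0..1}) \<subseteq> B" "P (\<lambda>x. K (x, 1))" by blast
  have "continuous_on ({0..1} \<times> cube q) (\<lambda>(t, x). K (x, t))"
    unfolding case_prod_beta
    by (rule continuous_on_compose2[OF K(1)])
      (auto intro!: continuous_on_Pair continuous_on_fst continuous_on_snd continuous_on_id)
  then show ?r
    using K by (intro exI[of _ "\<lambda>t x. K (x, t)"]) (auto simp: drags_def)
next
  assume ?r
  then obtain K where K: "drags J q A B \<gamma> f K" "P (K 1)" by blast
  have "continuous_on (cube q \<times> {0..1}) (\<lambda>(x, t). K t x)"
    unfolding case_prod_beta
    by (rule continuous_on_compose2[of "{0..1} \<times> cube q" "\<lambda>(t, x). K t x" _ "\<lambda>p. (snd p, fst p)",
          simplified case_prod_beta fst_conv snd_conv])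
      (use K(1) in \<open>auto intro!: continuous_on_Pair continuous_on_fst continuous_on_snd continuous_on_id
        simp: drags_def case_prod_beta\<close>)
  then show ?l
    using K by (intro exI[of _ "\<lambda>(x, t). K t x"]) (auto simp: drags_def image_subset_iff)
qed

lemma rel_action_eq:
  assumes "q \<ge> 1" "B \<subseteq> A" "loop_at B b \<gamma>" "f \<in> Frel q A B b" "drags (- {q}) q A B \<gamma> f K"
  shows "rel_action q A B b (loop_class B \<gamma>) (rel_class q A B b f) = rel_class q A B b (K 1)"
proof -
  have sides: "cube_sides q = faces (- {q}) q" by (simp add: cube_sides_def faces_def)
  show ?thesis
    using gen_action_eq[of q B A b \<gamma> f "- {q}" K] assms
    by (simp add: rel_action_def rel_class_eq_gen_class Frel_eq_Fgen sides
        ex_drags_iff[where P = "\<lambda>u. _ = gen_class _ _ _ _ _ u"])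
qed

lemma abs_action_eq:
  assumes "q \<ge> 1" "loop_at A b \<gamma>" "f \<in> Fabs q A b" "drags UNIV q A A \<gamma> f K"
  shows "abs_action q A b (loop_class A \<gamma>) (abs_class q A b f) = abs_class q A b (K 1)"
proof -
  have sides: "cube_boundary q = faces UNIV q" by (auto simp: cube_boundary_def faces_def)
  \<comment> \<open>The definition of the absolute action says nothing about the bottom face; for
    \<open>B = A\<close> the condition in \<open>drags\<close> follows from the one on the whole
    cube.\<close>
  have bottom: "K ` (cube_bottom q \<times> {0..1}) \<subseteq> A"
    if "K ` (cube q \<times> {0..1}) \<subseteq> A" for K :: "(nat \<Rightarrow> real) \<times> real \<Rightarrow> 'a"
    using that bottom_subset[of q] by blast
  have iff: "(\<exists>K :: (nat \<Rightarrow> real) \<times> real \<Rightarrow> 'a.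
       continuous_on (cube q \<times> {0..1}) K \<and> K ` (cube q \<times> {0..1}) \<subseteq> A \<and>
       (\<forall>x\<in>cube q. K (x, 0) = f x) \<and>
       (\<forall>x\<in>faces UNIV q. \<forall>t\<in>{0..1}. K (x, t) = reversepath \<gamma> t) \<and> e = gen_class UNIV q A A b (\<lambda>x. K (x, 1)))
     \<longleftrightarrow> (\<exists>K. drags UNIV q A A \<gamma> f K \<and> e = gen_class UNIV q A A b (K 1))" for f \<gamma> e
    unfolding ex_drags_iff[where P = "\<lambda>u. e = gen_class _ _ _ _ _ u", symmetric]
    by (rule ex_cong1) (use bottom in blast)
  show ?thesis
    using gen_action_eq[of q A A b \<gamma> f UNIV K] assms
    by (simp add: abs_action_def abs_class_eq_gen_class Fabs_eq_Fgen sides iff)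
qed

section \<open>The variation\<close>

lemma cube_upd: "x \<in> cube q \<Longrightarrow> q \<ge> 1 \<Longrightarrow> 0 \<le> r \<Longrightarrow> r \<le> 1 \<Longrightarrow> x(q := r) \<in> cube q"
  by (auto simp: cube_def PiE_iff extensional_def)

text \<open>On the cut \<open>x q = 1/2\<close> both halves evaluate \<open>F t\<close> at last
  coordinate 0. That value lies in \<open>B\<close>, where \<open>h\<close> is the identity, so the
  halves agree.\<close>

lemma continuous_on_perp:
  fixes F :: "real \<Rightarrow> (nat \<Rightarrow> real) \<Rightarrow> 'a::topological_space"
  assumes q: "q \<ge> 1" and F: "continuous_on (S \<times> cube q) (\<lambda>(t, x). F t x)"
    and A: "\<And>t. t \<in> S \<Longrightarrow> F t ` cube q \<subseteq> A" and B: "\<And>t. t \<in> S \<Longrightarrow> F t ` cube_bottom q \<subseteq> B"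
    and h: "continuous_on A h" "\<And>x. x \<in> B \<Longrightarrow> h x = x"
  shows "continuous_on (S \<times> cube q) (\<lambda>(t, x). perp q (F t) (h \<circ> F t) x)"
proof -
  let ?U = "S \<times> cube q"
  define P Q where "P = {p \<in> ?U. snd p q \<le> 1/2}" and "Q = {p \<in> ?U. snd p q \<ge> 1/2}"
  have coord: "continuous_on W (\<lambda>p :: real \<times> (nat \<Rightarrow> real). snd p k)" for W k
    by (rule continuous_on_product_then_coordinatewise) (intro continuous_intros)
  have upd: "continuous_on W (\<lambda>p :: real \<times> (nat \<Rightarrow> real). (fst p, (snd p)(q := c + d * snd p q)))" for W c d
  proof (intro continuous_on_Pair continuous_on_fst continuous_on_id continuous_on_coordinatewise_then_product)
    fix k show "continuous_on W (\<lambda>p :: real \<times> (nat \<Rightarrow> real). ((snd p)(q := c + d * snd p q)) k)"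
      by (cases "k = q") (auto intro!: continuous_intros coord)
  qed
  \<comment> \<open>The affine form covers both reparametrizations: \<open>c = 1\<close>,
    \<open>d = -2\<close> for the lower half and \<open>c = -1\<close>, \<open>d = 2\<close> for the
    upper one.\<close>
  have F1: "continuous_on W (\<lambda>p. F (fst p) ((snd p)(q := c + d * snd p q)))"
    if "W \<subseteq> ?U" "\<And>p. p \<in> W \<Longrightarrow> c + d * snd p q \<in> {0..1}" for W c d
  proof -
    have "continuous_on W (\<lambda>p. (\<lambda>(t, x). F t x) (fst p, (snd p)(q := c + d * snd p q)))"
      by (rule continuous_on_compose2[OF F upd]) (use that q in \<open>force intro!: cube_upd\<close>)
    then show ?thesis by simp
  qed
  have in01: "0 \<le> x q" "x q \<le> 1" if "x \<in> cube q" for x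
    using cube_coord[OF that, of q] q by auto
  have U: "?U = P \<union> Q" by (auto simp: P_def Q_def)
  have clP: "closedin (top_of_set ?U) P"
  proof -
    have "P = ?U \<inter> (\<lambda>p. snd p q) -` {..1/2}" by (auto simp: P_def)
    then show ?thesis by (metis continuous_closedin_preimage[OF coord closed_atMost])
  qed
  have clQ: "closedin (top_of_set ?U) Q"
  proof -
    have "Q = ?U \<inter> (\<lambda>p. snd p q) -` {1/2..}" by (auto simp: Q_def)
    then show ?thesis by (metis continuous_closedin_preimage[OF coord closed_atLeast])
  qed
  have cP: "continuous_on P (\<lambda>(t, x). perp q (F t) (h \<circ> F t) x)"
    by (rule continuous_on_eq[OF F1[of P 1 "-2"]])
      (use in01 in \<open>fastforce simp: P_def perp_def case_prod_beta\<close>)+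
  have "continuous_on Q (\<lambda>p. h (F (fst p) ((snd p)(q := -1 + 2 * snd p q))))"
    by (rule continuous_on_compose2[OF h(1) F1])
      (use in01 q A in \<open>fastforce simp: Q_def image_subset_iff intro!: cube_upd\<close>)+
  then have cQ: "continuous_on Q (\<lambda>(t, x). perp q (F t) (h \<circ> F t) x)"
  proof (rule continuous_on_eq)
    fix p assume p: "p \<in> Q"
    obtain t x where [simp]: "p = (t, x)" by (cases p)
    have tx: "t \<in> S" "x \<in> cube q" "x q \<ge> 1/2" using p by (auto simp: Q_def)
    show "h (F (fst p) ((snd p)(q := -1 + 2 * snd p q))) = (\<lambda>(t, x). perp q (F t) (h \<circ> F t) x) p"
    proof (cases "x q = 1/2")
      \<comment> \<open>On the cut \<open>perp\<close> takes its first branch, without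
        \<open>h\<close>.\<close>
      case True
      have "x(q := 0) \<in> cube_bottom q" using tx q by (simp add: cube_bottom_def cube_upd)
      then have "F t (x(q := 0)) \<in> B" using B[OF tx(1)] by blast
      moreover have "perp q (F t) (h \<circ> F t) x = F t (x(q := 0))"
        unfolding perp_def True by simp
      moreover have "h (F (fst p) ((snd p)(q := -1 + 2 * snd p q))) = h (F t (x(q := 0)))"
        unfolding \<open>p = (t, x)\<close> fst_conv snd_conv True by simp
      ultimately show ?thesis using h(2) by simp
    qed (use tx in \<open>simp add: perp_def\<close>)
  qed
  show ?thesis
    unfolding U by (rule continuous_on_Un_local[OF _ _ cP cQ]) (use clP clQ U in simp_all)
qed

lemma perp_in:
  assumes "q \<ge> 1" "f ` cube q \<subseteq> A" "h ` A \<subseteq> A" "x \<in> cube q"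
  shows "perp q f (h \<circ> f) x \<in> A"
proof -
  have "0 \<le> x q" "x q \<le> 1" using cube_coord[OF assms(4), of q] assms(1) by auto
  then show ?thesis
    using assms cube_upd[OF assms(4,1)] by (auto simp: perp_def image_subset_iff)
qed

text \<open>The faces \<open>x q = 0\<close> and \<open>x q = 1\<close> are both sent to the top
  face of \<open>f\<close>, and the remaining faces to themselves, so only prescribed sides are met.
  The value \<open>c\<close> is arbitrary because it moves along the path during a dragging.\<close>

lemma perp_faces:
  assumes q: "q \<ge> 1" and f: "\<And>x. x \<in> faces (- {q}) q \<Longrightarrow> f x = c" and h: "h c = c"
    and x: "x \<in> faces UNIV q"
  shows "perp q f (h \<circ> f) x = c"
proof -
  have xc: "x \<in> cube q" and bounds: "0 \<le> x q" "x q \<le> 1"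
    using x cube_coord[of x q q] q by (auto simp: faces_def)
  obtain k where k: "k \<in> {1..q}" "x k = 1 \<or> x k = 0" using x by (auto simp: faces_def)
  have side: "x(q := r) \<in> faces (- {q}) q" if "0 \<le> r" "r \<le> 1" "k \<noteq> q \<or> r = 1" for r
  proof -
    have "x(q := r) \<in> cube q" using that xc q by (simp add: cube_upd)
    then show ?thesis using that k q unfolding faces_def by (auto intro!: bexI[of _ k])
  qed
  show ?thesis
  proof (cases "x q \<le> 1/2")
    case True
    have "k \<noteq> q \<or> 1 - 2 * x q = 1" using k True by auto
    then show ?thesis using True bounds f[OF side[of "1 - 2 * x q"]] by (simp add: perp_def)
  next
    case False
    have "k \<noteq> q \<or> 2 * x q - 1 = 1" using k False by auto
    then show ?thesis using False bounds f[OF side[of "2 * x q - 1"]] h by (simp add: perp_def)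
  qed
qed

section \<open>The variation on homotopy classes and its equivariance\<close>

context
  fixes q :: nat and A B :: "'a::topological_space set" and b :: 'a and h :: "'a \<Rightarrow> 'a"
  assumes q: "q \<ge> 1" and b: "b \<in> B" and BA: "B \<subseteq> A"
    and h: "continuous_on A h" "h ` A \<subseteq> A" "\<And>x. x \<in> B \<Longrightarrow> h x = x"
begin

text \<open>Applying \<open>perp\<close> to each stage of a relative homotopy gives an absolute one,
  as every stage sends its bottom face into \<open>B\<close>, which \<open>h\<close> fixes
  pointwise.\<close>

lemma perp_homotopic:
  assumes "f' \<in> rel_class q A B b f"
  shows "perp q f' (h \<circ> f') \<in> abs_class q A b (perp q f (h \<circ> f))"
proof -
  obtain F :: "real \<Rightarrow> (nat \<Rightarrow> real) \<Rightarrow> 'a" where F: "continuous_on ({0..1} \<times> cube q) (\<lambda>(t, x). F t x)"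
    "\<And>t. t \<in> {0..1} \<Longrightarrow> F t \<in> Fgen (- {q}) q A B b"
    "\<And>x. x \<in> cube q \<Longrightarrow> F 0 x = f x" "\<And>x. x \<in> cube q \<Longrightarrow> F 1 x = f' x"
    by (rule gen_classE[OF assms[unfolded rel_class_eq_gen_class]]) (rule that)
  have F': "F t ` cube q \<subseteq> A" "F t ` cube_bottom q \<subseteq> B" "\<And>x. x \<in> faces (- {q}) q \<Longrightarrow> F t x = b"
    if "t \<in> {0..1}" for t
    using F(2)[OF that] by (auto simp: Fgen_def)
  let ?H = "\<lambda>t. perp q (F t) (h \<circ> F t)"
  have H: "continuous_on ({0..1} \<times> cube q) (\<lambda>(t, x). ?H t x)"
    by (rule continuous_on_perp[OF q F(1) F'(1,2) h(1,3)])
  have Hf: "?H t \<in> Fgen UNIV q A A b" if t: "t \<in> {0..1}" for t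
  proof -
    have "continuous_on (cube q) (\<lambda>x. (\<lambda>(t, x). ?H t x) (t, x))"
      by (rule continuous_on_compose2[OF H]) (use t in \<open>auto intro!: continuous_intros\<close>)
    moreover have "?H t x \<in> A" if "x \<in> cube q" for x
      by (rule perp_in[OF q F'(1)[OF t] h(2) that])
    moreover have "?H t x = b" if "x \<in> faces UNIV q" for x
      by (rule perp_faces) (use q F'(3)[OF t] h(3)[OF b] that in auto)
    ultimately show ?thesis using bottom_subset[of q] by (auto simp: Fgen_def)
  qed
  \<comment> \<open>The ends of the homotopy agree with \<open>f\<close> and \<open>f'\<close> only
    on the cube, and there \<open>perp\<close> evaluates its arguments only at points of the
    cube.\<close>
  have cong: "perp q g (h \<circ> g) x = perp q g' (h \<circ> g') x"
    if "x \<in> cube q" "\<And>y. y \<in> cube q \<Longrightarrow> g y = g' y" for g g' x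
    using that cube_coord[OF that(1), of q] cube_upd[OF that(1) q] q by (auto simp: perp_def)
  show ?thesis
    unfolding abs_class_eq_gen_class
    by (rule gen_classI[of q ?H, OF H Hf]) (auto intro!: cong F(3,4))
qed

lemma VAR_eq:
  assumes "f \<in> Frel q A B b"
  shows "VAR q A b h (rel_class q A B b f) = abs_class q A b (perp q f (h \<circ> f))"
  unfolding VAR_def
proof (rule the_equality)
  show "\<exists>f'\<in>rel_class q A B b f. abs_class q A b (perp q f (h \<circ> f)) = abs_class q A b (perp q f' (h \<circ> f'))"
    using assms gen_class_refl unfolding rel_class_eq_gen_class Frel_eq_Fgen by blast
  show "e = abs_class q A b (perp q f (h \<circ> f))"
    if "\<exists>f'\<in>rel_class q A B b f. e = abs_class q A b (perp q f' (h \<circ> f'))" for e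
    using that perp_homotopic gen_class_eq unfolding abs_class_eq_gen_class by metis
qed

lemma VAR_action:
  assumes \<gamma>: "loop_at B b \<gamma>" and f: "f \<in> Frel q A B b"
  shows "VAR q A b h (rel_action q A B b (loop_class B \<gamma>) (rel_class q A B b f))
    = abs_action q A b (loop_class A \<gamma>) (VAR q A b h (rel_class q A B b f))"
proof -
  obtain K where K: "drags (- {q}) q A B \<gamma> f K"
    using drags_exists[OF q BA \<gamma>] f unfolding Frel_eq_Fgen by blast
  have K1: "K 1 \<in> Frel q A B b"
    using gen_class_imp_Fgen[OF drags_homotopic_collar[OF q BA \<gamma> K]] by (simp add: Frel_eq_Fgen)
  \<comment> \<open>Since \<open>f\<close> lies in its own class, membership is a by-product of
    \<open>perp_homotopic\<close>.\<close>
  have perp: "perp q f (h \<circ> f) \<in> Fabs q A b"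
    using f perp_homotopic gen_class_refl gen_class_imp_Fgen
    unfolding abs_class_eq_gen_class rel_class_eq_gen_class Frel_eq_Fgen Fabs_eq_Fgen by blast
  have \<gamma>A: "loop_at A b \<gamma>" using \<gamma> BA by (auto simp: loop_at_def)
  have K': "continuous_on ({0..1} \<times> cube q) (\<lambda>(t, x). K t x)"
    "\<And>t. t \<in> {0..1} \<Longrightarrow> K t ` cube q \<subseteq> A" "\<And>t. t \<in> {0..1} \<Longrightarrow> K t ` cube_bottom q \<subseteq> B"
    "\<And>x. x \<in> cube q \<Longrightarrow> K 0 x = f x"
    "\<And>x t. x \<in> faces (- {q}) q \<Longrightarrow> t \<in> {0..1} \<Longrightarrow> K t x = reversepath \<gamma> t"
    using K by (auto simp: drags_def)
  let ?H = "\<lambda>t. perp q (K t) (h \<circ> K t)"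
  \<comment> \<open>The common value on the sides is now a point of the loop; it lies in
    \<open>B\<close> and is therefore fixed by \<open>h\<close>.\<close>
  have "?H t x = reversepath \<gamma> t" if "t \<in> {0..1}" "x \<in> faces UNIV q" for t x
    by (rule perp_faces[OF q K'(5) _ that(2)])
      (use that reversepath_loop(2)[OF \<gamma>] h(3) in \<open>auto simp: image_subset_iff\<close>)
  moreover have "?H t x \<in> A" if "t \<in> {0..1}" "x \<in> cube q" for t x
    by (rule perp_in[OF q K'(2)[OF that(1)] h(2) that(2)])
  moreover have "?H 0 x = perp q f (h \<circ> f) x" if "x \<in> cube q" for x
    using K'(4) cube_coord[OF that, of q] cube_upd[OF that q] q by (auto simp: perp_def)
  moreover have "continuous_on ({0..1} \<times> cube q) (\<lambda>(t, x). ?H t x)"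
    by (rule continuous_on_perp[OF q K'(1-3) h(1,3)])
  ultimately have "drags UNIV q A A \<gamma> (perp q f (h \<circ> f)) ?H"
    using bottom_subset[of q] by (auto simp: drags_def)
  \<comment> \<open>Both sides become the class of \<open>perp q (K 1) (h \<circ> K 1)\<close>: on
    the left as the variation of \<open>K 1\<close>, on the right as the end of
    \<open>?H\<close>.\<close>
  then show ?thesis
    using rel_action_eq[OF q BA \<gamma> f K] VAR_eq[OF f] VAR_eq[OF K1] abs_action_eq[OF q \<gamma>A perp]
    by simp
qed

end

section \<open>Monodromies of a pencil\<close>

lemma pencil_axis_subset: "pencil_axis a b \<subseteq> pencil a b \<mu>"
proof
  fix p assume p: "p \<in> pencil_axis a b"
  have "(\<Sum>j\<in>UNIV. (s *s a + t *s b) $ j * v $ j)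
      = s * (\<Sum>j\<in>UNIV. a $ j * v $ j) + t * (\<Sum>j\<in>UNIV. b $ j * v $ j)" for s t v
    by (simp add: sum_distrib_left algebra_simps sum.distrib)
  then show "p \<in> pencil a b \<mu>"
    using p by (simp add: pencil_axis_def pencil_def hyperplane_def)
qed

text \<open>At time 1 the loop is back at \<open>\<mu>\<close>, so the isotopy ends in a
  homeomorphism of the member over \<open>\<mu>\<close> onto itself. On that member \<open>h\<close>
  agrees with it, and the axis lies in every member.\<close>

lemma geometric_monodromy_properties:
  assumes h: "geometric_monodromy a b \<mu> X E \<omega> h" and \<omega>: "pathfinish \<omega> = \<mu>"
  shows "continuous_on (pencil a b \<mu> \<inter> X) h" "h ` (pencil a b \<mu> \<inter> X) \<subseteq> pencil a b \<mu> \<inter> X"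
    "\<And>x. x \<in> pencil_axis a b \<inter> X \<Longrightarrow> h x = x"
proof -
  let ?A = "pencil a b \<mu> \<inter> X"
  obtain \<Theta> \<psi> where "homeomorphism ?A (over a b X {\<omega> 1}) (\<lambda>x. \<Theta> (x, 1 :: real)) \<psi>"
    and axis: "\<forall>x \<in> pencil_axis a b \<inter> X. \<Theta> (x, 1) = x"
    and h': "\<forall>x \<in> ?A. h x = \<Theta> (x, 1)"
    using h unfolding geometric_monodromy_def by (metis atLeastAtMost_iff order_refl zero_le_one)
  moreover have "over a b X {\<omega> 1} = ?A"
    using \<omega> by (auto simp: over_def pathfinish_def)
  ultimately have hom: "homeomorphism ?A ?A (\<lambda>x. \<Theta> (x, 1)) \<psi>" by simp
  show "continuous_on ?A h"
    using homeomorphism_cont1[OF hom] h' by (auto intro: continuous_on_eq)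
  show "h ` ?A \<subseteq> ?A"
    using homeomorphism_image1[OF hom] h' by auto
  show "h x = x" if "x \<in> pencil_axis a b \<inter> X" for x
    using that axis h' pencil_axis_subset[of a b \<mu>] by auto
qed

theorem lemma4p6:
  fixes Y Z X \<L> \<M> :: "'n::finite pspace set"
    and \<S> :: "'n pspace set set"
    and a b :: "complex ^ 'n"
    and \<mu>0 :: "2 pspace"
    and I :: "'i set" and l :: "'i \<Rightarrow> 2 pspace"
    and D :: "'i \<Rightarrow> 2 pspace set" and g :: "'i \<Rightarrow> real \<Rightarrow> 2 pspace"
    and \<beta> :: "real \<Rightarrow> 2 pspace"
    and h :: "'n pspace \<Rightarrow> 'n pspace"
    and pt :: "'n pspace" and q :: nat
    and \<gamma> :: "real \<Rightarrow> 'n pspace" and f :: "(nat \<Rightarrow> real) \<Rightarrow> 'n pspace"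
  assumes dim: "CARD('n) - 1 \<ge> 2"
    and Y: "closed_algebraic Y" "Y \<noteq> {}"
    and Z: "closed_algebraic Z" "Z \<subset> Y"
    and X: "X = Y - Z"
    and strat: "whitney_stratification Y \<S>" "\<exists>\<T>\<subseteq>\<S>. Z = \<Union>\<T>"
    and ab: "lin_indep2 a b"
    and L: "\<L> = pencil a b \<mu>0" "transverse_to_strata \<L> \<S>"
    and M: "\<M> = pencil_axis a b" "transverse_to_strata \<M> \<S>"
    and pt: "pt \<in> \<M> \<inter> X"
    and exc: "exceptional_parameters a b \<S> \<mu>0 I l"
    and loops: "disks_and_arcs \<mu>0 I l D g"
    and i: "i \<in> I"
    and \<beta>: "ccw_boundary_loop (D i) (l i) \<beta>" "pathstart \<beta> = pathfinish (g i)"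
    and h: "geometric_monodromy a b \<mu>0 X (frontier (path_image (g i) \<union> D i)) (lasso (g i) \<beta>) h"
    and q: "q \<ge> 1"
    and \<gamma>: "loop_at (\<M> \<inter> X) pt \<gamma>"
    and f: "f \<in> Frel q (\<L> \<inter> X) (\<M> \<inter> X) pt"
  shows "VAR q (\<L> \<inter> X) pt h
           (rel_action q (\<L> \<inter> X) (\<M> \<inter> X) pt (loop_class (\<M> \<inter> X) \<gamma>)
             (rel_class q (\<L> \<inter> X) (\<M> \<inter> X) pt f))
       = abs_action q (\<L> \<inter> X) pt (loop_class (\<L> \<inter> X) \<gamma>)
           (VAR q (\<L> \<inter> X) pt h (rel_class q (\<L> \<inter> X) (\<M> \<inter> X) pt f))"
proof -
  \<comment> \<open>The lasso closes with the reversed arc, which ends where the arc starts, at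
    \<open>\<mu>0\<close>.\<close>
  have "pathfinish (lasso (g i) \<beta>) = \<mu>0"
    using loops i by (simp add: lasso_def disks_and_arcs_def)
  note mono = geometric_monodromy_properties[OF h this]
  show ?thesis
    unfolding L(1) M(1)
  proof (rule VAR_action[OF q])
    show "pt \<in> pencil_axis a b \<inter> X" "loop_at (pencil_axis a b \<inter> X) pt \<gamma>"
      "f \<in> Frel q (pencil a b \<mu>0 \<inter> X) (pencil_axis a b \<inter> X) pt"
      using pt \<gamma> f unfolding L(1) M(1) by auto
  qed (use mono pencil_axis_subset[of a b \<mu>0] in auto)
qed

end
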